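(* If $G$ is a connected split graph that is not a complete graph (and not isomorphic to $K_2$ or $K_3$), then $\mathcal{D}_{\mathrm{lir}}(G) \leq 1$.
   Context: A split graph is a graph whose vertex set can be partitioned into a clique $X$ and an independent set $Y$. A (multi)graph is locally irregular if the two endvertices of every edge have different degrees (counting parallel edges with multiplicity). For $E_d \subseteq E(G)$, $G + E_d$ is the multigraph obtained by replacing each edge of $E_d$ by two parallel edges. For a connected graph $G$ not isomorphic to $K_2$ or $K_3$, $\mathcal{D}_{\mathrm{lir}}(G)$ is the minimum size of a set $E_d \subseteq E(G)$ such that the edges of $G+E_d$ can be colored with at most two colors so that each color class induces a locally irregular submultigraph and parallel edges receive the same color. *)

theory Defs
  imports Main "HOL-Library.Multiset" "HOL-Library.Extended_Nat"
begin

definition simple_graph :: "'a set \<Rightarrow> 'a set set \<Rightarrow> bool" where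
  "simple_graph V E \<longleftrightarrow> finite V \<and> (\<forall>e\<in>E. e \<subseteq> V \<and> card e = 2)"

definition adjacency :: "'a set set \<Rightarrow> ('a \<times> 'a) set" where
  "adjacency E = {(u, v). {u, v} \<in> E}"

definition connected_graph :: "'a set \<Rightarrow> 'a set set \<Rightarrow> bool" where
  "connected_graph V E \<longleftrightarrow> V \<noteq> {} \<and> (\<forall>u\<in>V. \<forall>v\<in>V. (u, v) \<in> (adjacency E)\<^sup>*)"

definition clique :: "'a set set \<Rightarrow> 'a set \<Rightarrow> bool" where
  "clique E X \<longleftrightarrow> (\<forall>u\<in>X. \<forall>v\<in>X. u \<noteq> v \<longrightarrow> {u, v} \<in> E)"

definition independent_set :: "'a set set \<Rightarrow> 'a set \<Rightarrow> bool" where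
  "independent_set E Y \<longleftrightarrow> (\<forall>u\<in>Y. \<forall>v\<in>Y. {u, v} \<notin> E)"

definition split_graph :: "'a set \<Rightarrow> 'a set set \<Rightarrow> bool" where
  "split_graph V E \<longleftrightarrow>
     (\<exists>X Y. X \<union> Y = V \<and> X \<inter> Y = {} \<and> clique E X \<and> independent_set E Y)"

definition complete_graph :: "'a set \<Rightarrow> 'a set set \<Rightarrow> bool" where
  "complete_graph V E \<longleftrightarrow> clique E V"

definition graph_isomorphic ::
    "'a set \<Rightarrow> 'a set set \<Rightarrow> 'b set \<Rightarrow> 'b set set \<Rightarrow> bool" where
  "graph_isomorphic V E W F \<longleftrightarrow>
     (\<exists>f. bij_betw f V W \<and> (\<forall>u\<in>V. \<forall>v\<in>V. {u, v} \<in> E \<longleftrightarrow> {f u, f v} \<in> F))"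

definition K_verts :: "nat \<Rightarrow> nat set" where
  "K_verts n = {..<n}"

definition K_edges :: "nat \<Rightarrow> nat set set" where
  "K_edges n = {{i, j} | i j. i < n \<and> j < n \<and> i \<noteq> j}"

text \<open>
  The edges of a loopless multigraph are a multiset of two-element vertex sets. Isolated
  vertices are irrelevant for local irregularity, so a (sub)multigraph is given by its edges alone.
\<close>

definition mdegree :: "'a set multiset \<Rightarrow> 'a \<Rightarrow> nat" where
  "mdegree M v = size (filter_mset (\<lambda>e. v \<in> e) M)"

definition locally_irregular :: "'a set multiset \<Rightarrow> bool" where
  "locally_irregular M \<longleftrightarrow> (\<forall>u v. {u, v} \<in># M \<longrightarrow> mdegree M u \<noteq> mdegree M v)"

definition double_edges :: "'a set set \<Rightarrow> 'a set set \<Rightarrow> 'a set multiset" where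
  "double_edges E Ed = mset_set E + mset_set Ed"

text \<open>
  A colouring assigns a colour to every two-element vertex set. Hence parallel
  edges, which are equal as sets, automatically receive the same colour.
\<close>

definition lir_2_colouring :: "'a set multiset \<Rightarrow> ('a set \<Rightarrow> nat) \<Rightarrow> bool" where
  "lir_2_colouring M c \<longleftrightarrow>
     (\<forall>e\<in>#M. c e < 2) \<and> (\<forall>i<2. locally_irregular (filter_mset (\<lambda>e. c e = i) M))"

text \<open>
  The infimum is taken in \<^typ>\<open>enat\<close>: it is the minimum if a suitable \<open>Ed\<close> exists, and
  \<open>\<infinity>\<close> (not an unspecified number) otherwise.
\<close>

definition D_lir :: "'a set set \<Rightarrow> enat" where
  "D_lir E = (INF Ed \<in> {Ed. Ed \<subseteq> E \<and> (\<exists>c. lir_2_colouring (double_edges E Ed) c)}. enat (card Ed))"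

end

theory Submission
  imports Defs
begin

text \<open>
  Write the split graph as a clique \<open>X\<close> with \<open>n\<close> vertices and an independent set \<open>Y\<close>, where no vertex
  of \<open>Y\<close> sees all of \<open>X\<close>. Number the clique \<open>0, \<dots>, n - 1\<close> and colour the edge \<open>{i, j}\<close> red iff
  \<open>i + j\<close> is below a threshold near \<open>n\<close>. The red degrees inside the clique are then distinct, except for
  one pair of twins in the middle. The edges to \<open>Y\<close> at the lower half of the numbers are red, those at
  the upper half blue; numbering each half by the number of neighbours in \<open>Y\<close> only spreads the degrees
  further.

  If at least half of the clique vertices have a neighbour in \<open>Y\<close>, then one of the twins can be given
  such a neighbour, so that the twins differ in the colour of the edge joining them. Otherwise let \<open>v\<close> be a
  clique vertex with a neighbour in \<open>Y\<close> and number it last. Doubling one blue edge lifts one twin over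
  the other; the collision of the lifted twin with the next vertex is avoided by recolouring the edge
  between these two and compensating along a closed walk through \<open>v\<close>, whose blue degree exceeds all
  others. The cliques with 4, 5 or 6 vertices are too small for this and get a different doubled edge.
\<close>

section \<open>Colourings given by a numbering of the clique\<close>

text \<open>Since \<open>E\<close> and \<open>Ed\<close> are sets, a degree in
  \<open>double_edges E Ed\<close> is a sum of two cardinalities, and each edge has to be checked
  only in its own colour. This removes multisets and the infimum from what follows.\<close>

lemma D_lir_le_1I:
  fixes col :: "'a set \<Rightarrow> bool"
  assumes "finite E" "Ed \<subseteq> E" "card Ed \<le> 1"
    and irr: "\<And>u v. {u, v} \<in> E \<Longrightarrow>
      card {e \<in> E. u \<in> e \<and> col e = col {u, v}} + card {e \<in> Ed. u \<in> e \<and> col e = col {u, v}} \<noteq>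
      card {e \<in> E. v \<in> e \<and> col e = col {u, v}} + card {e \<in> Ed. v \<in> e \<and> col e = col {u, v}}"
  shows "D_lir E \<le> 1"
proof -
  define c :: "'a set \<Rightarrow> nat" where "c e = of_bool (col e)" for e
  have "finite Ed" using assms(1,2) finite_subset by blast
  have deg: "mdegree (filter_mset (\<lambda>e. c e = c f) (double_edges E Ed)) v =
      card {e \<in> E. v \<in> e \<and> col e = col f} + card {e \<in> Ed. v \<in> e \<and> col e = col f}" for f v
  proof -
    have "c e = c f \<longleftrightarrow> col e = col f" for e by (auto simp: c_def)
    moreover have "{e \<in> A. col e = col f \<and> v \<in> e} = {e \<in> A. v \<in> e \<and> col e = col f}" for A
      by blast
    ultimately show ?thesis
      using \<open>finite E\<close> \<open>finite Ed\<close>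
      by (simp add: mdegree_def double_edges_def filter_mset_mset_set filter_filter_mset)
  qed
  have "lir_2_colouring (double_edges E Ed) c"
    unfolding lir_2_colouring_def
  proof (intro conjI allI impI ballI)
    show "c e < 2" for e by (simp add: c_def)
    show "locally_irregular (filter_mset (\<lambda>e. c e = i) (double_edges E Ed))" for i
      unfolding locally_irregular_def
    proof (intro allI impI)
      fix u v assume *: "{u, v} \<in># filter_mset (\<lambda>e. c e = i) (double_edges E Ed)"
      then have i: "i = c {u, v}" by simp
      have "{u, v} \<in> E"
        using * \<open>finite E\<close> \<open>finite Ed\<close> \<open>Ed \<subseteq> E\<close> by (auto simp: double_edges_def)
      then show "mdegree (filter_mset (\<lambda>e. c e = i) (double_edges E Ed)) u \<noteq>
          mdegree (filter_mset (\<lambda>e. c e = i) (double_edges E Ed)) v"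
        using irr[of u v] unfolding i deg by simp
    qed
  qed
  then have "D_lir E \<le> enat (card Ed)"
    unfolding D_lir_def using \<open>Ed \<subseteq> E\<close> by (intro INF_lower) auto
  also have "\<dots> \<le> 1" using assms(3) by (simp add: one_enat_def)
  finally show ?thesis .
qed

section \<open>Edges and degrees of a split graph in terms of numbers\<close>

text \<open>The numbering \<open>g\<close> stays arbitrary here: the colourings are arithmetic
  patterns on numbers, and a numbering that suits a pattern is chosen only at the end.
  \<open>edge_cases\<close> encodes both the independence of \<open>Y\<close> and the absence of
  loops.\<close>

locale split_indexing =
  fixes X Y :: "'a set" and E :: "'a set set" and g :: "nat \<Rightarrow> 'a" and n :: nat
  assumes finite_Y: "finite Y" and disjoint: "X \<inter> Y = {}"
    and clique_X: "clique E X"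
    and edge_cases: "\<And>e. e \<in> E \<Longrightarrow>
      (\<exists>x\<in>X. \<exists>x'\<in>X. x \<noteq> x' \<and> e = {x, x'}) \<or> (\<exists>x\<in>X. \<exists>y\<in>Y. e = {x, y})"
    and bij: "bij_betw g {..<n} X"
begin

definition attached :: "nat \<Rightarrow> 'a set" where
  "attached i = {y \<in> Y. {g i, y} \<in> E}"

lemma finite_attached [simp]: "finite (attached i)"
  using finite_Y by (simp add: attached_def)

lemma g_mem [simp]: "i < n \<Longrightarrow> g i \<in> X"
  using bij by (auto simp: bij_betw_def)

lemma g_eq_iff [simp]: "i < n \<Longrightarrow> j < n \<Longrightarrow> g i = g j \<longleftrightarrow> i = j"
  using bij by (auto simp: bij_betw_def inj_on_def)

lemma g_not_Y [simp]: "i < n \<Longrightarrow> g i \<notin> Y"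
  using g_mem disjoint by blast

lemma g_neq_Y [simp]: "i < n \<Longrightarrow> y \<in> Y \<Longrightarrow> g i \<noteq> y" "i < n \<Longrightarrow> y \<in> Y \<Longrightarrow> y \<noteq> g i"
  using g_not_Y by blast+

lemma attached_D [dest]: "y \<in> attached i \<Longrightarrow> y \<in> Y"
  by (simp add: attached_def)

lemma edge_iff:
  "e \<in> E \<longleftrightarrow> (\<exists>i<n. \<exists>j<n. i \<noteq> j \<and> e = {g i, g j}) \<or> (\<exists>i<n. \<exists>y\<in>attached i. e = {g i, y})"
proof
  assume e: "e \<in> E"
  have X: "X = g ` {..<n}" using bij by (simp add: bij_betw_def)
  from edge_cases[OF e] show "(\<exists>i<n. \<exists>j<n. i \<noteq> j \<and> e = {g i, g j}) \<or> (\<exists>i<n. \<exists>y\<in>attached i. e = {g i, y})"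
    using e unfolding X attached_def by fastforce
next
  assume "(\<exists>i<n. \<exists>j<n. i \<noteq> j \<and> e = {g i, g j}) \<or> (\<exists>i<n. \<exists>y\<in>attached i. e = {g i, y})"
  then show "e \<in> E" using clique_X by (auto simp: attached_def clique_def)
qed

lemma edge_index_cases [consumes 1, case_names clique pendant]:
  assumes "e \<in> E"
  obtains p q where "p < n" "q < n" "p \<noteq> q" "e = {g p, g q}"
    | p y where "p < n" "y \<in> attached p" "e = {g p, y}"
  using assms unfolding edge_iff by blast

text \<open>
  The degree in colour \<open>b\<close> of the clique vertex numbered \<open>i\<close>. The clique edge between \<open>i\<close> and \<open>j\<close> has
  colour \<open>red i j\<close>, all edges between \<open>i\<close> and \<open>Y\<close> have colour \<open>s i\<close>, and \<open>F\<close> consists of the doubled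
  clique edges, as sets of numbers.
\<close>

definition colour_degree :: "(nat \<Rightarrow> nat \<Rightarrow> bool) \<Rightarrow> (nat \<Rightarrow> bool) \<Rightarrow> nat set set \<Rightarrow> bool \<Rightarrow> nat \<Rightarrow> nat" where
  "colour_degree red s F b i = card {j. j < n \<and> j \<noteq> i \<and> red i j = b} + (if s i = b then card (attached i) else 0)
     + card {f \<in> F. i \<in> f \<and> (\<forall>p\<in>f. \<forall>q\<in>f. p \<noteq> q \<longrightarrow> red p q = b)}"

text \<open>Only clique edges are doubled, and an edge to \<open>Y\<close> takes its colour from its
  clique end. So the degree of a vertex of \<open>Y\<close> in one colour just counts its neighbours
  \<open>k\<close> whose \<open>s k\<close> is this colour, as in \<open>XY\<close>.\<close>

lemma D_lir_le_1_index:
  assumes sym: "\<And>i j. red i j = red j i"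
    and F: "F = {} \<or> (\<exists>p q. p < n \<and> q < n \<and> p \<noteq> q \<and> F = {{p, q}})"
    and XX: "\<And>i j. i < j \<Longrightarrow> j < n \<Longrightarrow> colour_degree red s F (red i j) i \<noteq> colour_degree red s F (red i j) j"
    and XY: "\<And>i y. i < n \<Longrightarrow> y \<in> attached i \<Longrightarrow>
      colour_degree red s F (s i) i \<noteq> card {k. k < n \<and> s k = s i \<and> y \<in> attached k}"
  shows "D_lir E \<le> 1"
proof -
  define col where "col e \<longleftrightarrow> (\<exists>i<n. \<exists>j<n. i \<noteq> j \<and> e = {g i, g j} \<and> red i j) \<or>
      (\<exists>i<n. \<exists>y\<in>Y. e = {g i, y} \<and> s i)" for e
  \<comment> \<open>Symmetry of \<open>red\<close> makes the colour independent of which end is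
    named first.\<close>
  have colX: "col {g i, g j} = red i j" if "i < n" "j < n" "i \<noteq> j" for i j
  proof -
    have "(\<exists>i'<n. \<exists>j'<n. i' \<noteq> j' \<and> {g i, g j} = {g i', g j'} \<and> red i' j') = red i j"
      using that sym[of i j] by (auto simp: doubleton_eq_iff)
    moreover have "\<not> (\<exists>i'<n. \<exists>y\<in>Y. {g i, g j} = {g i', y} \<and> s i')"
      using that by (auto simp: doubleton_eq_iff)
    ultimately show ?thesis unfolding col_def by argo
  qed
  have colY: "col {g i, y} = s i" if "i < n" "y \<in> Y" for i y
    using that by (auto simp: col_def doubleton_eq_iff)
  have inj1: "inj_on (\<lambda>j. {g i, g j}) {j. j < n \<and> j \<noteq> i \<and> red i j = b}" if "i < n" for i b
    using that by (auto simp: inj_on_def doubleton_eq_iff)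
  have inj2: "inj_on (\<lambda>y. {g i, y}) (attached i)" for i
    by (auto simp: inj_on_def doubleton_eq_iff)
  have degX: "card {e \<in> E. g i \<in> e \<and> col e = b} =
      card {j. j < n \<and> j \<noteq> i \<and> red i j = b} + (if s i = b then card (attached i) else 0)" (is "_ = card ?J + _")
    if i: "i < n" for i b
  proof -
    let ?K = "if s i = b then attached i else {}"
    have eq: "{e \<in> E. g i \<in> e \<and> col e = b} = (\<lambda>j. {g i, g j}) ` ?J \<union> (\<lambda>y. {g i, y}) ` ?K"
      (is "?l = ?r")
    proof (intro equalityI subsetI)
      fix e assume e: "e \<in> ?l"
      then have "e \<in> E" by simp
      then show "e \<in> ?r"
      proof (cases rule: edge_index_cases)
        case (clique p q)
        then have "p = i \<or> q = i" using e i by auto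
        then obtain j where j: "j < n" "j \<noteq> i" "e = {g i, g j}"
          using clique by (metis insert_commute)
        then have "j \<in> ?J" using e i colX[of i j] by simp
        then show ?thesis using j by blast
      next
        case (pendant p y)
        have "y \<in> Y" using pendant by blast
        then have "p = i" using e i pendant by simp
        then have "y \<in> ?K" using pendant e i colY[OF i \<open>y \<in> Y\<close>] by simp
        then show ?thesis using pendant \<open>p = i\<close> by blast
      qed
    next
      fix e assume "e \<in> ?r"
      then consider j where "j \<in> ?J" "e = {g i, g j}" | y where "y \<in> attached i" "s i = b" "e = {g i, y}"
        by (auto split: if_splits)
      then show "e \<in> ?l"
      proof cases
        case 1
        then have "e \<in> E" using i unfolding edge_iff by blast
        then show ?thesis using 1 i colX[of i j] by simp
      next
        case 2
        then have "e \<in> E" using i unfolding edge_iff by blast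
        moreover have "y \<in> Y" using 2 by blast
        ultimately show ?thesis using 2 i colY[of i y] by simp
      qed
    qed
    have "g j \<noteq> y" if "j \<in> ?J" "y \<in> ?K" for j y
      using that g_neq_Y(1)[of j y] attached_D by (auto split: if_splits)
    then have "(\<lambda>j. {g i, g j}) ` ?J \<inter> (\<lambda>y. {g i, y}) ` ?K = {}"
      using inj2 by (auto simp: doubleton_eq_iff)
    moreover have "card ((\<lambda>y. {g i, y}) ` ?K) = (if s i = b then card (attached i) else 0)"
      using card_image[OF inj2] by simp
    moreover have "finite ?J" "finite ?K" by auto
    ultimately show ?thesis
      using card_image[OF inj1[OF i]] unfolding eq by (subst card_Un_disjoint) auto
  qed
  have degY: "card {e \<in> E. y \<in> e \<and> col e = b} = card {k. k < n \<and> s k = b \<and> y \<in> attached k}"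
    if y: "y \<in> Y" for y b
  proof -
    have "{e \<in> E. y \<in> e \<and> col e = b} = (\<lambda>k. {g k, y}) ` {k. k < n \<and> s k = b \<and> y \<in> attached k}" (is "?l = ?r")
    proof (intro set_eqI iffI)
      fix e assume e: "e \<in> ?l"
      then have "e \<in> E" by simp
      then show "e \<in> ?r"
      proof (cases rule: edge_index_cases)
        case (clique p q)
        then show ?thesis using e y by auto
      next
        case (pendant p y')
        then have "y' = y" using e y by auto
        then show ?thesis using pendant e y colY by auto
      qed
    next
      fix e assume "e \<in> ?r"
      then show "e \<in> ?l" using colY y by (auto simp: attached_def)
    qed
    moreover have "inj_on (\<lambda>k. {g k, y}) {k. k < n \<and> s k = b \<and> y \<in> attached k}"
      using y by (auto simp: inj_on_def doubleton_eq_iff)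
    ultimately show ?thesis by (simp add: card_image)
  qed
  define Ed where "Ed = (\<lambda>f. g ` f) ` F"
  have dblX: "card {e \<in> Ed. g i \<in> e \<and> col e = b} =
      card {f \<in> F. i \<in> f \<and> (\<forall>p\<in>f. \<forall>q\<in>f. p \<noteq> q \<longrightarrow> red p q = b)}" if i: "i < n" for i b
    using F
  proof
    assume "\<exists>p q. p < n \<and> q < n \<and> p \<noteq> q \<and> F = {{p, q}}"
    then obtain p q where pq: "p < n" "q < n" "p \<noteq> q" "F = {{p, q}}" by blast
    have "{e \<in> Ed. g i \<in> e \<and> col e = b} = (if i \<in> {p, q} \<and> red p q = b then {{g p, g q}} else {})"
      using pq i colX[of p q] by (auto simp: Ed_def)
    moreover have "{f \<in> F. i \<in> f \<and> (\<forall>p\<in>f. \<forall>q\<in>f. p \<noteq> q \<longrightarrow> red p q = b)} =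
        (if i \<in> {p, q} \<and> red p q = b then {{p, q}} else {})"
      using pq sym[of p q] by auto
    ultimately show ?thesis by simp
  qed (simp add: Ed_def)
  have dblY: "{e \<in> Ed. y \<in> e \<and> col e = b} = {}" if "y \<in> Y" for y b
    using F that by (auto simp: Ed_def)
  have totX: "card {e \<in> E. g i \<in> e \<and> col e = b} + card {e \<in> Ed. g i \<in> e \<and> col e = b} =
      colour_degree red s F b i" if "i < n" for i b
    by (simp only: degX[OF that] dblX[OF that] colour_degree_def)
  have totY: "card {e \<in> E. y \<in> e \<and> col e = b} + card {e \<in> Ed. y \<in> e \<and> col e = b} =
      card {k. k < n \<and> s k = b \<and> y \<in> attached k}" if "y \<in> Y" for y b
    by (simp add: degY[OF that] dblY[OF that])
  have fin: "finite E"
  proof -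
    have "E \<subseteq> Pow (X \<union> Y)"
      using edge_cases by blast
    moreover have "finite X" using bij bij_betw_finite by blast
    ultimately show ?thesis using finite_Y finite_subset by blast
  qed
  have Ed: "Ed \<subseteq> E" "card Ed \<le> 1"
    using F by (auto simp: Ed_def edge_iff) blast
  show ?thesis
  proof (rule D_lir_le_1I[OF fin Ed, of col])
    fix u v assume uv: "{u, v} \<in> E"
    have XXs: "colour_degree red s F (red i j) i \<noteq> colour_degree red s F (red i j) j" if "i \<noteq> j" "i < n" "j < n" for i j
    proof (cases "i < j")
      case False
      then have "colour_degree red s F (red i j) j \<noteq> colour_degree red s F (red i j) i"
        using XX[of j i] that sym[of j i] by simp
      then show ?thesis by (rule not_sym)
    qed (use XX that in blast)
    from uv[unfolded edge_iff] consider p q where "p < n" "q < n" "p \<noteq> q" "u = g p" "v = g q"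
        | p y where "p < n" "y \<in> attached p" "u = g p" "v = y"
        | p y where "p < n" "y \<in> attached p" "v = g p" "u = y"
      unfolding doubleton_eq_iff by metis
    then show "card {e \<in> E. u \<in> e \<and> col e = col {u, v}} + card {e \<in> Ed. u \<in> e \<and> col e = col {u, v}} \<noteq>
      card {e \<in> E. v \<in> e \<and> col e = col {u, v}} + card {e \<in> Ed. v \<in> e \<and> col e = col {u, v}}"
    proof cases
      case 1
      show ?thesis
        unfolding 1(4,5) colX[OF 1(1-3)] totX[OF 1(1)] totX[OF 1(2)] by (rule XXs[OF 1(3,1,2)])
    next
      case 2
      then have y: "y \<in> Y" by blast
      show ?thesis
        unfolding 2(3,4) colY[OF 2(1) y] totX[OF 2(1)] totY[OF y] by (rule XY[OF 2(1,2)])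
    next
      case 3
      then have y: "y \<in> Y" by blast
      have col: "col {y, g p} = s p" using colY[OF 3(1) y] by (simp add: insert_commute)
      show ?thesis
        unfolding 3(3,4) col totX[OF 3(1)] totY[OF y] by (rule not_sym[OF XY[OF 3(1,2)]])
    qed
  qed
qed

end

section \<open>Half graphs\<close>

text \<open>The neighbours of \<open>i\<close> form \<open>{..<k - i}\<close> without
  \<open>i\<close>, and \<open>i\<close> lies in this set iff \<open>2 * i < k\<close>. Because of
  this loss of one, the last \<open>i\<close> with \<open>2 * i < k\<close> and its successor have
  equal degrees: these are the twins.\<close>

lemma card_half_graph:
  fixes n i k :: nat
  assumes "k \<le> n"
  shows "card {j. j < n \<and> j \<noteq> i \<and> i + j < k} = (if 2 * i < k then k - i - 1 else k - i)"
proof -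
  have "{j. j < n \<and> j \<noteq> i \<and> i + j < k} = {..<k - i} - {i}"
    using assms by auto
  then show ?thesis by (auto simp: card_Diff_singleton_if)
qed

lemma card_complement:
  fixes n i :: nat
  assumes "i < n"
  shows "card {j. j < n \<and> j \<noteq> i \<and> \<not> P j} = n - 1 - card {j. j < n \<and> j \<noteq> i \<and> P j}"
proof -
  have "{j. j < n \<and> j \<noteq> i \<and> \<not> P j} = ({..<n} - {i}) - {j. j < n \<and> j \<noteq> i \<and> P j}"
    by auto
  moreover have "card ({..<n} - {i} - {j. j < n \<and> j \<noteq> i \<and> P j}) =
      card ({..<n} - {i}) - card {j. j < n \<and> j \<noteq> i \<and> P j}"
    by (rule card_Diff_subset) auto
  ultimately show ?thesis using assms by (simp add: card_Diff_singleton)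
qed

text \<open>A vertex that exchanges one red neighbour for another keeps its red degree. This is
  applied to the inner vertices of a recoloured closed walk.\<close>

lemma card_swap:
  assumes "finite A" "x \<in> A" "y \<notin> A"
  shows "card (insert y (A - {x})) = card A"
proof -
  have "card A > 0" using assms card_gt_0_iff by blast
  then show ?thesis using assms by (simp add: card_Diff_singleton)
qed

context split_indexing
begin

lemma colour_degree_True:
  "colour_degree red s {} True i = card {j. j < n \<and> j \<noteq> i \<and> red i j} + (if s i then card (attached i) else 0)"
  by (simp add: colour_degree_def)

lemma colour_degree_False:
  "i < n \<Longrightarrow> colour_degree red s {} False i =
    n - 1 - card {j. j < n \<and> j \<noteq> i \<and> red i j} + (if s i then 0 else card (attached i))"
  by (simp add: colour_degree_def card_complement)

lemma colour_degree_doubled: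
  assumes "\<And>i j. red i j = red j i" "p \<noteq> q"
  shows "colour_degree red s {{p, q}} b i = colour_degree red s {} b i + (if (i = p \<or> i = q) \<and> red p q = b then 1 else 0)"
proof -
  have "{f \<in> {{p, q}}. i \<in> f \<and> (\<forall>p\<in>f. \<forall>q\<in>f. p \<noteq> q \<longrightarrow> red p q = b)} =
        (if i \<in> {p, q} \<and> red p q = b then {{p, q}} else {})"
    using assms(1)[of p q] assms(2) by auto
  then show ?thesis by (simp add: colour_degree_def)
qed

lemma attached_nonempty: "y \<in> attached i \<Longrightarrow> 0 < card (attached i)"
  by (auto simp: card_gt_0_iff)

section \<open>Many clique vertices with neighbours in the independent set\<close>

text \<open>No edge is doubled. With threshold \<open>n - 1\<close> the twins are
  \<open>n div 2 - 1\<close> and \<open>n div 2\<close>. Their edge is blue for even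
  \<open>n\<close> and red for odd \<open>n\<close>, and \<open>pos_even\<close> or
  \<open>pos_odd\<close> raises one of them in that colour. \<open>dec\<close> and
  \<open>inc\<close> preserve the other gaps; \<open>full_even\<close> and \<open>full_odd\<close>
  settle the one tight case at edges to \<open>Y\<close>.\<close>

lemma D_lir_le_1_many:
  assumes n: "2 \<le> n"
    and dec: "\<And>i j. i \<le> j \<Longrightarrow> j < n div 2 \<Longrightarrow> card (attached j) \<le> card (attached i)"
    and inc: "\<And>i j. n div 2 \<le> i \<Longrightarrow> i \<le> j \<Longrightarrow> j < n \<Longrightarrow> card (attached i) \<le> card (attached j)"
    and pos_even: "even n \<Longrightarrow> 0 < card (attached (n div 2))"
    and pos_odd: "odd n \<Longrightarrow> 0 < card (attached (n div 2 - 1))"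
    and full_even: "\<And>y i. even n \<Longrightarrow> (\<forall>k<n div 2. y \<in> attached k) \<Longrightarrow> i < n div 2 \<Longrightarrow> 2 \<le> card (attached i)"
    and full_odd: "\<And>y i. odd n \<Longrightarrow> (\<forall>k\<in>{n div 2..<n}. y \<in> attached k) \<Longrightarrow> i \<in> {n div 2..<n}
      \<Longrightarrow> 2 \<le> card (attached i)"
  shows "D_lir E \<le> 1"
proof -
  define a where "a = n div 2"
  define red where "red i j \<longleftrightarrow> i + j < n - 1" for i j :: nat
  define s where "s i \<longleftrightarrow> i < a" for i
  define d where "d i = card (attached i)" for i
  have a: "if even n then n = 2 * a else n = 2 * a + 1" "1 \<le> a" using n by (auto simp: a_def)
  have a': "n = 2 * a \<or> n = 2 * a + 1" using a by presburger
  have T1: "colour_degree red s {} True i = n - 2 - i + d i" if "i < a" for i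
    unfolding colour_degree_True red_def using card_half_graph[of "n - 1" n i] that a n
    by (auto simp: s_def d_def split: if_splits)
  have T2: "colour_degree red s {} True i = n - 1 - i" if "a \<le> i" "i < n" for i
    unfolding colour_degree_True red_def using card_half_graph[of "n - 1" n i] that a n
    by (auto simp: s_def d_def split: if_splits)
  have F1: "colour_degree red s {} False i = i + 1" if "i < a" for i
    using colour_degree_False[of i red s] card_half_graph[of "n - 1" n i] that a n
    by (auto simp: s_def d_def red_def split: if_splits)
  have F2: "colour_degree red s {} False i = i + d i" if "a \<le> i" "i < n" for i
    using colour_degree_False[of i red s] card_half_graph[of "n - 1" n i] that a n
    by (auto simp: s_def d_def red_def split: if_splits)
  have dec': "d j \<le> d i" if "i \<le> j" "j < a" for i j using dec that by (simp add: a_def d_def)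
  have inc': "d i \<le> d j" if "a \<le> i" "i \<le> j" "j < n" for i j using inc that by (simp add: a_def d_def)
  have pos: "even n \<Longrightarrow> 0 < d a" "odd n \<Longrightarrow> 0 < d (a - 1)"
    using pos_even pos_odd by (auto simp: a_def d_def)
  show ?thesis
  proof (rule D_lir_le_1_index[of red "{}" s])
    fix i j assume ij: "i < j" "j < n"
    show "colour_degree red s {} (red i j) i \<noteq> colour_degree red s {} (red i j) j"
    proof (cases "red i j")
      case True
      then have "i + j < n - 1" by (simp add: red_def)
      then have i: "i < a" using ij a by (auto split: if_splits)
      show ?thesis
      proof (cases "j < a")
        case True
        then show ?thesis using \<open>red i j\<close> i ij T1 dec'[of i j] a by (auto split: if_splits)
      next
        case False
        show ?thesis
        \<comment> \<open>Apart from the twins, \<open>j\<close> is at least \<open>i + 2\<close>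
          here, which outweighs the difference of one between the formulas \<open>T1\<close> and
          \<open>T2\<close>.\<close>
        proof (cases "i = a - 1 \<and> j = a")
          case True
          then show ?thesis using \<open>red i j\<close> \<open>i + j < n - 1\<close> i ij T1 T2[of j] a pos by (auto split: if_splits)
        next
          case False
          then show ?thesis using \<open>red i j\<close> \<open>\<not> j < a\<close> i ij T1 T2[of j] a by (auto split: if_splits)
        qed
      qed
    next
      case False
      then have "n - 1 \<le> i + j" by (simp add: red_def)
      then have j: "a \<le> j" using ij a by (auto split: if_splits)
      show ?thesis
      proof (cases "i < a")
        case False
        then show ?thesis using \<open>\<not> red i j\<close> j ij F2 inc'[of i j] a by (auto split: if_splits)
      next
        case True
        show ?thesis
        proof (cases "i = a - 1 \<and> j = a")
          case True
          then show ?thesis using \<open>\<not> red i j\<close> \<open>n - 1 \<le> i + j\<close> j ij F1 F2[of j] a pos by (auto split: if_splits)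
        next
          case False
          then show ?thesis using \<open>\<not> red i j\<close> \<open>i < a\<close> j ij F1 F2[of j] a by (auto split: if_splits)
        qed
      qed
    qed
  next
    fix i y assume i: "i < n" and y: "y \<in> attached i"
    have d: "0 < d i" using y attached_nonempty by (simp add: d_def)
    define c where "c = card {k. k < n \<and> s k = s i \<and> y \<in> attached k}"
    have "colour_degree red s {} (s i) i \<noteq> c"
    proof (cases "i < a")
      case True
      have sub: "{k. k < n \<and> s k = s i \<and> y \<in> attached k} \<subseteq> {..<a}" using True by (auto simp: s_def)
      have le: "c \<le> a" unfolding c_def using card_mono[OF _ sub] by simp
      have full: "2 \<le> d i" if "c = a" "even n"
      proof -
        have "{k. k < n \<and> s k = s i \<and> y \<in> attached k} = {..<a}"
          using card_subset_eq[OF finite_lessThan sub] that by (simp add: c_def)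
        then have "\<forall>k<n div 2. y \<in> attached k" unfolding a_def by blast
        then show ?thesis using full_even[of y i] that(2) True unfolding d_def a_def by blast
      qed
      have deg: "colour_degree red s {} (s i) i = n - 2 - i + d i" using T1 True by (simp add: s_def)
      show ?thesis
      proof
        assume eq: "colour_degree red s {} (s i) i = c"
        note e = eq[unfolded deg]
        \<comment> \<open>The degree is at least \<open>a\<close>, and more than \<open>a\<close> if
          \<open>n\<close> is odd. So equality leaves \<open>n\<close> even and
          \<open>c = a\<close>: \<open>y\<close> sees the whole lower half, and then
          \<open>d i\<close> is at least 2.\<close>
        have ev: "n = 2 * a" using e le d True a' by linarith
        then have "c = a" using e le d True by linarith
        then have "2 \<le> d i" using full ev by simp
        then show False using ev e le True by linarith
      qed
    next
      case False
      have sub: "{k. k < n \<and> s k = s i \<and> y \<in> attached k} \<subseteq> {a..<n}" using False by (auto simp: s_def)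
      have le: "c \<le> n - a" unfolding c_def using card_mono[OF _ sub] by simp
      have full: "2 \<le> d i" if "c = n - a" "odd n"
      proof -
        have "{k. k < n \<and> s k = s i \<and> y \<in> attached k} = {a..<n}"
          using card_subset_eq[OF finite_atLeastLessThan sub] that by (simp add: c_def)
        then have "\<forall>k\<in>{n div 2..<n}. y \<in> attached k" unfolding a_def by blast
        moreover have "i \<in> {n div 2..<n}" using False i by (simp add: a_def)
        ultimately show ?thesis using full_odd[of y i] that(2) unfolding d_def by blast
      qed
      have deg: "colour_degree red s {} (s i) i = i + d i" using F2 False i by (simp add: s_def)
      show ?thesis
      proof
        assume eq: "colour_degree red s {} (s i) i = c"
        note e = eq[unfolded deg]
        \<comment> \<open>In the upper half the degree is at least \<open>a + 1\<close>, which
          exceeds \<open>n - a\<close> for even \<open>n\<close> and equals it for odd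
          \<open>n\<close>, so the parities exchange their roles.\<close>
        have od: "n = 2 * a + 1" using e le d False a' by linarith
        then have "c = n - a" using e le d False by linarith
        then have "2 \<le> d i" using full od by simp
        then show False using od e le False by linarith
      qed
    qed
    then show "colour_degree red s {} (s i) i \<noteq> card {k. k < n \<and> s k = s i \<and> y \<in> attached k}"
      by (simp add: c_def)
  qed (auto simp: red_def add.commute)
qed

section \<open>Few clique vertices with independent neighbours\<close>


text \<open>By \<open>zero\<close>, the clique neighbours of \<open>y\<close> have numbers below
  \<open>n div 2 - 2\<close> or equal to \<open>n - 1\<close>. So \<open>y\<close> has red degree at
  most \<open>n div 2 - 2\<close> and blue degree at most 1, and the two degree bounds exceed these
  values.\<close>

lemma few_attached_degree_neq:
  assumes n: "4 \<le> n"
    and zero: "\<And>i. n div 2 - 2 \<le> i \<Longrightarrow> i < n - 1 \<Longrightarrow> attached i = {}"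
    and red_deg: "\<And>i. i < n div 2 - 2 \<Longrightarrow> n div 2 - 1 \<le> colour_degree red (\<lambda>i. i < n div 2) F True i"
    and blue_deg: "2 \<le> colour_degree red (\<lambda>i. i < n div 2) F False (n - 1)"
    and i: "i < n" and y: "y \<in> attached i"
  shows "colour_degree red (\<lambda>i. i < n div 2) F (i < n div 2) i \<noteq>
    card {k. k < n \<and> (k < n div 2) = (i < n div 2) \<and> y \<in> attached k}"
proof -
  have "i < n div 2 - 2 \<or> i = n - 1" using zero[of i] y i by fastforce
  then show ?thesis
  proof
    assume i': "i < n div 2 - 2"
    have "{k. k < n \<and> (k < n div 2) = (i < n div 2) \<and> y \<in> attached k} \<subseteq> {..<n div 2 - 2}"
    proof
      fix k assume "k \<in> {k. k < n \<and> (k < n div 2) = (i < n div 2) \<and> y \<in> attached k}"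
      then have "k < n div 2" "y \<in> attached k" using i' by auto
      then show "k \<in> {..<n div 2 - 2}" using zero[of k] n by fastforce
    qed
    from card_mono[OF finite_lessThan this]
    have "card {k. k < n \<and> (k < n div 2) = (i < n div 2) \<and> y \<in> attached k} \<le> n div 2 - 2"
      by simp
    moreover have "n div 2 - 1 \<le> colour_degree red (\<lambda>i. i < n div 2) F (i < n div 2) i"
    proof -
      have "i < n div 2" using i' by linarith
      then show ?thesis using red_deg[OF i'] by simp
    qed
    ultimately show ?thesis using i' by linarith
  next
    assume i': "i = n - 1"
    then have ge: "\<not> i < n div 2" using n by linarith
    have "{k. k < n \<and> (k < n div 2) = (i < n div 2) \<and> y \<in> attached k} \<subseteq> {n - 1}"
    proof
      fix k assume "k \<in> {k. k < n \<and> (k < n div 2) = (i < n div 2) \<and> y \<in> attached k}"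
      then have "\<not> k < n div 2" "y \<in> attached k" "k < n" using ge by auto
      then show "k \<in> {n - 1}" using zero[of k] by fastforce
    qed
    from card_mono[OF _ this]
    have "card {k. k < n \<and> (k < n div 2) = (i < n div 2) \<and> y \<in> attached k} \<le> 1"
      by simp
    moreover have "2 \<le> colour_degree red (\<lambda>i. i < n div 2) F (i < n div 2) i"
      using blue_deg i' ge by simp
    ultimately show ?thesis by linarith
  qed
qed

text \<open>For the odd threshold \<open>2 * q + 1\<close> the twins \<open>q\<close> and
  \<open>q + 1\<close> are joined by a blue edge. Doubling the blue edge from \<open>q + 1\<close>
  to \<open>q + 2\<close> lifts \<open>q + 1\<close> above \<open>q\<close> and keeps
  \<open>q + 2\<close> above \<open>q + 1\<close>. Only \<open>n - 1\<close> can lie beyond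
  \<open>q + 2\<close>, and its neighbours in \<open>Y\<close> lift it further.\<close>

lemma D_lir_le_1_few_small:
  assumes n: "4 \<le> n" "n \<le> 6"
    and zero: "\<And>i. n div 2 - 2 \<le> i \<Longrightarrow> i < n - 1 \<Longrightarrow> attached i = {}"
    and pos: "attached (n - 1) \<noteq> {}"
  shows "D_lir E \<le> 1"
proof -
  \<comment> \<open>The threshold \<open>2 * q + 1\<close> is the odd one of \<open>n - 1\<close>
    and \<open>n\<close>.\<close>
  define q where "q = (n - 1) div 2"
  define red where "red i j \<longleftrightarrow> i + j < 2 * q + 1" for i j :: nat
  define s where "s i \<longleftrightarrow> i < n div 2" for i
  define d where "d i = card (attached i)" for i
  define D where "D = d (n - 1)"
  define F where "F = {{q + 1, q + 2}}"
  have q: "1 \<le> q" "q \<le> 2" "q + 3 \<le> n" "n \<le> q + 4" "2 * q + 1 \<le> n" "n \<le> 2 * q + 2" using n by (auto simp: q_def)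
  have sym: "red i j = red j i" for i j by (simp add: red_def add.commute)
  have dbl: "\<not> red (q + 1) (q + 2)" by (simp add: red_def)
  have c: "card {j. j < n \<and> j \<noteq> i \<and> red i j} = (if i \<le> q then 2 * q - i else 2 * q + 1 - i)" for i
    unfolding red_def using card_half_graph[OF q(5), of i] by simp
  \<comment> \<open>Since \<open>n div 2 - 2\<close> is at most 1, only the number 0 can have red
    edges to \<open>Y\<close>.\<close>
  have T: "colour_degree red s F True i = (if i \<le> q then 2 * q - i else 2 * q + 1 - i) + (if i = 0 then d 0 else 0)"
    if "i < n" for i
  proof -
    have "(if s i then d i else 0) = (if i = 0 then d 0 else 0)"
      using that zero[of i] n by (cases "i = 0") (auto simp: s_def d_def)
    moreover have "colour_degree red s F True i = (if i \<le> q then 2 * q - i else 2 * q + 1 - i) + (if s i then d i else 0)"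
      using colour_degree_doubled[of red "q + 1" "q + 2" s True i, OF sym] dbl
      by (simp add: colour_degree_True c d_def F_def)
    ultimately show ?thesis by simp
  qed
  have F: "colour_degree red s F False i = n - 1 - 2 * q + (if i \<le> q then i else i - 1) +
      (if i = n - 1 then D else 0) + (if i = q + 1 \<or> i = q + 2 then 1 else 0)" if i: "i < n" for i
  proof -
    have "(if s i then 0 else d i) = (if i = n - 1 then D else 0)"
      using i zero[of i] n by (auto simp: s_def d_def D_def)
    moreover have "n - 1 - (if i \<le> q then 2 * q - i else 2 * q + 1 - i) =
        n - 1 - 2 * q + (if i \<le> q then i else i - 1)"
      using q i by (cases "i \<le> q") auto
    moreover have "colour_degree red s F False i = n - 1 - (if i \<le> q then 2 * q - i else 2 * q + 1 - i) +
        (if s i then 0 else d i) + (if i = q + 1 \<or> i = q + 2 then 1 else 0)"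
      using colour_degree_doubled[of red "q + 1" "q + 2" s False i, OF sym] dbl i
      by (simp add: colour_degree_False c d_def F_def)
    ultimately show ?thesis by (simp only:)
  qed
  have dv: "0 < D" using pos by (simp add: D_def d_def card_gt_0_iff)
  show ?thesis
  proof (rule D_lir_le_1_index[of red F s, OF sym])
    fix i j assume ij: "i < j" "j < n"
    then have i: "i < n" by simp
    show "colour_degree red s F (red i j) i \<noteq> colour_degree red s F (red i j) j"
    proof (cases "red i j")
      case True
      then have "i + j < 2 * q + 1" by (simp add: red_def)
      then show ?thesis using True ij T[OF i] T[OF ij(2)] by (auto split: if_splits)
    next
      case False
      then have "2 * q + 1 \<le> i + j" by (simp add: red_def)
      then have j: "q + 1 \<le> j" using ij by linarith
      have "colour_degree red s F False i < colour_degree red s F False j"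
      proof (cases "i \<le> q")
        case True
        then have "i < (if j \<le> q then j else j - 1) + (if j = q + 1 \<or> j = q + 2 then 1 else 0)"
          using j ij by auto
        then show ?thesis unfolding F[OF i] F[OF ij(2)] using True q by auto
      next
        case False
        then have "j = n - 1 \<or> i = q + 1 \<and> j = q + 2" using ij q by linarith
        then show ?thesis unfolding F[OF i] F[OF ij(2)] using False dv ij by auto
      qed
      then show ?thesis using False by simp
    qed
  next
    fix i y assume "i < n" "y \<in> attached i"
    then show "colour_degree red s F (s i) i \<noteq> card {k. k < n \<and> s k = s i \<and> y \<in> attached k}"
      unfolding s_def
    proof (rule few_attached_degree_neq[rotated 4])
      show "n div 2 - 1 \<le> colour_degree red (\<lambda>i. i < n div 2) F True i" if "i < n div 2 - 2" for i
        using T[of i] that n unfolding s_def by (auto simp: q_def)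
      show "2 \<le> colour_degree red (\<lambda>i. i < n div 2) F False (n - 1)"
        using F[of "n - 1"] dv q n unfolding s_def by auto
    qed (use n zero in auto)
  next
    show "F = {} \<or> (\<exists>p q. p < n \<and> q < n \<and> p \<noteq> q \<and> F = {{p, q}})"
      unfolding F_def using q by (intro disjI2 exI[of _ "q + 1"] exI[of _ "q + 2"]) auto
  qed
qed


text \<open>
  The twins of the half graph \<open>i + j < n\<close> are \<open>h - 1\<close> and \<open>h\<close>. Doubling the blue edge from \<open>h - 1\<close> to
  \<open>n - 1\<close> separates them, but raises \<open>h - 1\<close> to the blue degree of \<open>h + 1\<close>, so that the edge between
  these two must become red. Recolouring the edges of the closed walk \<open>n - 1, 1, h + 1, h - 1, z, n - 1\<close>
  achieves this and changes only the degree of \<open>n - 1\<close>. If \<open>n\<close> is even, then the edge between the twins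
  is red and has to become blue, hence \<open>z = h\<close>.
\<close>

lemma D_lir_le_1_few_large:
  assumes n: "7 \<le> n"
    and dec: "\<And>i j. i \<le> j \<Longrightarrow> j < n div 2 \<Longrightarrow> card (attached j) \<le> card (attached i)"
    and zero: "\<And>i. n div 2 - 2 \<le> i \<Longrightarrow> i < n - 1 \<Longrightarrow> attached i = {}"
    and pos: "attached (n - 1) \<noteq> {}"
  shows "D_lir E \<le> 1"
proof -
  define h where "h = (n + 1) div 2"
  \<comment> \<open>For odd \<open>n\<close> the edge between the twins is blue already, and
    \<open>z\<close> only has to be a red neighbour of \<open>h - 1\<close> in the half graph other
    than 0 and 1. The number 2 will do because \<open>h\<close> is at least 4.\<close>
  define z where "z = (if even n then h else 2)"
  \<comment> \<open>The first set lists the edges of the walk that turn blue, the second those that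
    turn red.\<close>
  define red where "red i j \<longleftrightarrow> {i, j} \<notin> {{1, h + 1}, {h - 1, z}} \<and>
    ({i, j} \<in> {{h - 1, h + 1}, {1, n - 1}, {z, n - 1}} \<or> i + j < n)" for i j :: nat
  define s where "s i \<longleftrightarrow> i < n div 2" for i
  define d where "d i = card (attached i)" for i
  define e where "e i = (if s i then d i else 0)" for i
  define D where "D = d (n - 1)"
  define F where "F = {{h - 1, n - 1}}"
  have h: "4 \<le> h" "h + 2 < n" "n \<le> 2 * h" "2 * h \<le> n + 1" using n by (auto simp: h_def)
  have z: "2 \<le> z" "z \<noteq> h - 1" "z \<le> h" "z + h \<le> n" "z = h \<Longrightarrow> 2 * h = n \<and> 8 \<le> n"
    using h n by (auto simp: z_def h_def split: if_splits)
  have sym: "red i j = red j i" for i j by (simp add: red_def add.commute insert_commute)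
  have red_iff: "red i j \<longleftrightarrow>
      \<not> (i = 1 \<and> j = h + 1 \<or> i = h + 1 \<and> j = 1 \<or> i = h - 1 \<and> j = z \<or> i = z \<and> j = h - 1) \<and>
      (i = h - 1 \<and> j = h + 1 \<or> i = h + 1 \<and> j = h - 1 \<or> i = 1 \<and> j = n - 1 \<or> i = n - 1 \<and> j = 1 \<or>
       i = z \<and> j = n - 1 \<or> i = n - 1 \<and> j = z \<or> i + j < n)" for i j
    unfolding red_def by (simp add: doubleton_eq_iff)
  have dbl: "\<not> red (h - 1) (n - 1)"
  proof -
    have "\<not> h - 1 + (n - 1) < n" "n - 1 \<noteq> h + 1" "n - 1 \<noteq> z" "h - 1 \<noteq> 1" "h - 1 \<noteq> n - 1"
      using h z by linarith+
    then show ?thesis using z(2) unfolding red_iff by metis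
  qed
  have hn: "h - 1 \<noteq> n - 1" using h by linarith
  have twins: "\<not> red (h - 1) h"
    using h n by (cases "even n") (auto simp: red_iff z_def h_def elim!: oddE)
  \<comment> \<open>Each vertex of the walk except \<open>n - 1\<close> has one edge turned red and
    one turned blue. At \<open>n - 1\<close>, where the walk of odd length closes, both edges turn
    red, so its red neighbours are 0, 1 and \<open>z\<close>.\<close>
  have card_red: "card {j. j < n \<and> j \<noteq> i \<and> red i j} =
      (if i = n - 1 then 3 else if 2 * i < n then n - i - 1 else n - i)" if i: "i < n" for i
  proof -
    let ?B = "{j. j < n \<and> j \<noteq> i \<and> i + j < n}"
    have B: "card ?B = (if 2 * i < n then n - i - 1 else n - i)" "finite ?B"
      by (simp_all add: card_half_graph)
    have swap: ?thesis
      if "{j. j < n \<and> j \<noteq> i \<and> red i j} = insert y (?B - {x})" "x \<in> ?B" "y \<notin> ?B" "i \<noteq> n - 1" for x y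
      using card_swap[OF B(2) that(2,3)] B(1) that(4) unfolding that(1) by simp
    consider "i = n - 1" | "i = 1" | "i = z" | "i = h - 1" | "i = h + 1"
      | "i \<noteq> 1" "i \<noteq> z" "i \<noteq> h - 1" "i \<noteq> h + 1" "i \<noteq> n - 1" by blast
    then show ?thesis
    proof cases
      case 1
      have "{j. j < n \<and> j \<noteq> i \<and> red i j} = {0, 1, z}"
        unfolding 1 red_iff using h z by auto
      then show ?thesis using 1 z by (simp add: card_insert_if)
    next
      case 2
      have "{j. j < n \<and> j \<noteq> i \<and> red i j} = insert (n - 1) (?B - {h + 1})"
        unfolding 2 red_iff using h z by auto
      then show ?thesis by (rule swap) (use 2 h z in auto)
    next
      case 3
      have "{j. j < n \<and> j \<noteq> i \<and> red i j} = insert (n - 1) (?B - {h - 1})"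
        unfolding 3 red_iff using h z by auto
      then show ?thesis by (rule swap) (use 3 h z in auto)
    next
      case 4
      have "{j. j < n \<and> j \<noteq> i \<and> red i j} = insert (h + 1) (?B - {z})"
        unfolding 4 red_iff using h z by auto
      then show ?thesis by (rule swap) (use 4 h z in auto)
    next
      case 5
      have "{j. j < n \<and> j \<noteq> i \<and> red i j} = insert (h - 1) (?B - {1})"
        unfolding 5 red_iff using h z by auto
      then show ?thesis by (rule swap) (use 5 h z in auto)
    next
      case 6
      have "{j. j < n \<and> j \<noteq> i \<and> red i j} = ?B"
        unfolding red_iff using 6 by auto
      then show ?thesis using B 6 by simp
    qed
  qed
  have e0: "e i = 0" if "n div 2 - 2 \<le> i" for i
    using zero[of i] that n by (auto simp: e_def s_def d_def)
  have e_dec: "e j \<le> e i" if "i < j" for i j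
    using dec[of i j] that by (auto simp: e_def s_def d_def)
  have T: "colour_degree red s F True i = (if i = n - 1 then 3 else if 2 * i < n then n - i - 1 else n - i) + e i"
    if "i < n" for i
    using colour_degree_doubled[of red "h - 1" "n - 1" s True i, OF sym] dbl h
    by (simp add: colour_degree_True card_red[OF that] d_def e_def F_def)
  have F: "colour_degree red s F False i = (if i = n - 1 then n - 4 else if 2 * i < n then i else i - 1) +
      (if i = n - 1 then D else 0) + (if i = h - 1 \<or> i = n - 1 then 1 else 0)" if "i < n" for i
  proof -
    have "(if s i then 0 else d i) = (if i = n - 1 then D else 0)"
      using that zero[of i] n by (auto simp: s_def d_def D_def)
    moreover have "colour_degree red s F False i =
      n - 1 - (if i = n - 1 then 3 else if 2 * i < n then n - i - 1 else n - i) +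
      (if s i then 0 else d i) + (if i = h - 1 \<or> i = n - 1 then 1 else 0)"
      using colour_degree_doubled[of red "h - 1" "n - 1" s False i, OF sym hn] dbl
      unfolding F_def colour_degree_False[OF that] card_red[OF that] d_def by (simp only: simp_thms)
    moreover have "n - 1 - (if i = n - 1 then 3 else if 2 * i < n then n - i - 1 else n - i) =
        (if i = n - 1 then n - 4 else if 2 * i < n then i else i - 1)"
      using that n by (cases "i = n - 1"; cases "2 * i < n"; simp)
    ultimately show ?thesis by (simp only:)
  qed
  have lt_h: "2 * k < n \<longleftrightarrow> k < h" for k using h by linarith
  have dv: "0 < D" using pos by (simp add: D_def d_def card_gt_0_iff)
  show ?thesis
  proof (rule D_lir_le_1_index[of red F s, OF sym])
    fix i j assume ij: "i < j" "j < n"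
    then have i: "i < n" by simp
    show "colour_degree red s F (red i j) i \<noteq> colour_degree red s F (red i j) j"
    proof (cases "red i j")
      case True
      have ne: "\<not> (i = h - 1 \<and> j = h)" using True twins by blast
      have "colour_degree red s F True i \<noteq> colour_degree red s F True j"
      proof (cases "j = n - 1")
        case j: True
        have "n - 1 \<noteq> h + 1" "n - 1 \<noteq> h - 1" "i \<noteq> n - 1" using h ij by linarith+
        then have "i + (n - 1) < n \<or> i = 1 \<or> i = z" using \<open>red i j\<close> unfolding j red_iff by blast
        then have i_cases: "i = 0 \<or> i = 1 \<or> i = z" using h by linarith
        \<comment> \<open>The red neighbours of \<open>n - 1\<close> stay above its red degree 3.
          This uses that \<open>z\<close> differs from \<open>h - 1\<close> and, if
          \<open>z = h\<close>, that \<open>n\<close> is at least 8.\<close>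
        have "3 < (if i < h then n - i - 1 else n - i)"
        proof (cases "i < h")
          case True
          then have "i + 2 \<le> h" using i_cases h z(2) by linarith
          then show ?thesis using True h by simp
        next
          case False
          then have "i = h" "z = h" using i_cases h z(3) by linarith+
          then show ?thesis using z(5)[OF \<open>z = h\<close>] by simp linarith
        qed
        moreover have "e j = 0" "i \<noteq> n - 1" using e0 j ij by simp_all
        ultimately show ?thesis unfolding T[OF i] T[OF ij(2)] lt_h using j by simp
      next
        case j: False
        have "(if i < h then n - i - 1 else n - i) + e i \<noteq> (if j < h then n - j - 1 else n - j) + e j"
        proof (cases "j < h")
          case True
          then show ?thesis using ij e_dec[OF ij(1)] by simp
        next
          case False
          then have "e j = 0" using e0 h by simp
          then show ?thesis using False ne ij by (cases "i < h") auto
        qed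
        moreover have "i \<noteq> n - 1" using ij by linarith
        ultimately show ?thesis
          unfolding T[OF i] T[OF ij(2)] lt_h using j by (simp only: if_False not_False_eq_True)
      qed
      then show ?thesis using \<open>red i j\<close> by simp
    next
      case False
      have "red (h - 1) (h + 1)" using h z by (auto simp: red_iff)
      then have ne: "\<not> (i = h - 1 \<and> j = h + 1)" using False by blast
      have "colour_degree red s F False i \<noteq> colour_degree red s F False j"
      proof (cases "j = n - 1")
        case j: True
        \<comment> \<open>The blue degree of \<open>n - 1\<close> is \<open>n - 4\<close>, plus one
          for the doubled edge, plus the positive \<open>D\<close>, hence more than
          \<open>n - 3\<close>.\<close>
        have "(if i < h then i else i - 1) + (if i = h - 1 then 1 else 0) \<le> n - 3"
          using i ij j h by auto
        then show ?thesis unfolding F[OF i] F[OF ij(2)] lt_h using ij j dv h by simp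
      next
        case j: False
        \<comment> \<open>The lifted \<open>h - 1\<close> has blue degree \<open>h\<close>, shared
          below \<open>n - 1\<close> only by \<open>h + 1\<close>, and the edge between these two is
          red.\<close>
        have "(if i < h then i else i - 1) + (if i = h - 1 then 1 else 0) \<noteq>
          (if j < h then j else j - 1) + (if j = h - 1 then 1 else 0)"
        proof (cases "i < h")
          case True
          then consider "i = h - 1" | "i < h - 1" by linarith
          then show ?thesis
          proof cases
            case 1
            then show ?thesis using ne ij h by auto
          next
            case 2
            then show ?thesis using ij h by auto
          qed
        next
          case False
          then show ?thesis using ij h by auto
        qed
        moreover have "i \<noteq> n - 1" using ij by linarith
        ultimately show ?thesis
          unfolding F[OF i] F[OF ij(2)] lt_h using j by (simp only: if_False simp_thms add_0_right not_False_eq_True)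
      qed
      then show ?thesis using False by simp
    qed
  next
    fix i y assume "i < n" "y \<in> attached i"
    then show "colour_degree red s F (s i) i \<noteq> card {k. k < n \<and> s k = s i \<and> y \<in> attached k}"
      unfolding s_def
    proof (rule few_attached_degree_neq[rotated 4])
      show "n div 2 - 1 \<le> colour_degree red (\<lambda>i. i < n div 2) F True i" if "i < n div 2 - 2" for i
        using T[of i] that n unfolding s_def by auto
      show "2 \<le> colour_degree red (\<lambda>i. i < n div 2) F False (n - 1)"
        using F[of "n - 1"] dv n unfolding s_def by auto
    qed (use n zero in auto)
  next
    show "F = {} \<or> (\<exists>p q. p < n \<and> q < n \<and> p \<noteq> q \<and> F = {{p, q}})"
      unfolding F_def using h by (intro disjI2 exI[of _ "h - 1"] exI[of _ "n - 1"]) auto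
  qed
qed

end

section \<open>Choosing the numbering\<close>

text \<open>With each \<open>i\<close> the set contains \<open>{..i}\<close>, which gives
  \<open>i < card I\<close>; equal cardinalities do the rest.\<close>

lemma finite_down_closed_nat:
  fixes I :: "nat set"
  assumes "finite I" and down: "\<And>i j. j \<in> I \<Longrightarrow> i \<le> j \<Longrightarrow> i \<in> I"
  shows "I = {..<card I}"
proof (rule card_subset_eq)
  show "I \<subseteq> {..<card I}"
  proof
    fix i assume "i \<in> I"
    then have "{..i} \<subseteq> I" using down by auto
    from card_mono[OF \<open>finite I\<close> this] show "i \<in> {..<card I}" by simp
  qed
qed auto

lemma sorted_enumeration:
  fixes f :: "'a \<Rightarrow> nat"
  assumes X: "finite X" and A: "A \<subseteq> X"
  obtains g where "bij_betw g {..<card X} X"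
    "\<And>i. i < card X \<Longrightarrow> g i \<in> A \<longleftrightarrow> i < card A"
    "\<And>i j. i \<le> j \<Longrightarrow> j < card A \<Longrightarrow> f (g j) \<le> f (g i)"
    "\<And>i j. card A \<le> i \<Longrightarrow> i \<le> j \<Longrightarrow> j < card X \<Longrightarrow> f (g i) \<le> f (g j)"
proof -
  \<comment> \<open>One integer key yields both orders: on \<open>A\<close> it is negative and
    decreasing in \<open>f\<close>, elsewhere nonnegative and increasing. Sorting by it puts
    \<open>A\<close> first.\<close>
  define key where "key x = (if x \<in> A then - int (f x) - 1 else int (f x))" for x
  obtain ys where ys: "set ys = X" "distinct ys" using finite_distinct_list[OF X] by blast
  define xs where "xs = sort_key key ys"
  have xs: "set xs = X" "distinct xs" "length xs = card X"
    using ys by (auto simp: xs_def distinct_card)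
  have mono: "key (xs ! i) \<le> key (xs ! j)" if "i \<le> j" "j < card X" for i j
    using that xs(3) sorted_nth_mono[of "map key xs" i j] by (simp add: xs_def)
  have bij: "bij_betw ((!) xs) {..<card X} X"
    using bij_betw_nth[OF xs(2)] xs by auto
  define I where "I = {i \<in> {..<card X}. xs ! i \<in> A}"
  have "bij_betw ((!) xs) I A"
    unfolding bij_betw_def
  proof
    show "inj_on ((!) xs) I" using bij by (auto simp: bij_betw_def I_def intro: inj_on_subset)
    show "(!) xs ` I = A" using bij A by (auto simp: bij_betw_def I_def)
  qed
  then have card_I: "card I = card A" by (rule bij_betw_same_card)
  have "I = {..<card I}"
  proof (rule finite_down_closed_nat)
    fix i j assume j: "j \<in> I" and ij: "i \<le> j"
    then have "key (xs ! i) \<le> key (xs ! j)" using mono by (simp add: I_def)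
    moreover have "key (xs ! j) < 0" using j by (simp add: I_def key_def)
    ultimately have "xs ! i \<in> A" by (auto simp: key_def split: if_splits)
    then show "i \<in> I" using j ij by (simp add: I_def)
  qed (simp add: I_def)
  then have mem: "xs ! i \<in> A \<longleftrightarrow> i < card A" if "i < card X" for i
    using that card_I by (auto simp: I_def)
  have cA: "card A \<le> card X" using card_mono[OF X A] .
  show thesis
  proof (rule that[OF bij mem])
    show "f (xs ! j) \<le> f (xs ! i)" if "i \<le> j" "j < card A" for i j
      using mono[of i j] mem[of i] mem[of j] that cA by (simp add: key_def)
    show "f (xs ! i) \<le> f (xs ! j)" if "card A \<le> i" "i \<le> j" "j < card X" for i j
      using mono[of i j] mem[of i] mem[of j] that by (simp add: key_def)
  qed
qed

text \<open>\<open>C\<close> will be the half with the twin that needs a neighbour; its complement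
  has to avoid the tight case. If some \<open>N w\<close> is empty, keeping \<open>w\<close> outside
  \<open>C\<close> makes the last property vacuous. If instead some \<open>N z\<close> is
  \<open>{y0}\<close>, keeping \<open>z\<close> and a vertex missing \<open>y0\<close> outside has
  the same effect, for which \<open>k + 2\<close> elements are needed. Otherwise every
  \<open>N x\<close> has at least two elements.\<close>

lemma obtain_attached_set:
  fixes N :: "'a \<Rightarrow> 'b set"
  assumes X: "finite X" and k: "k \<le> card {x \<in> X. N x \<noteq> {}}" "k + 2 \<le> card X"
    and not_all: "\<And>y. \<exists>x\<in>X. y \<notin> N x"
    and fin: "\<And>x. x \<in> X \<Longrightarrow> finite (N x)"
  obtains C where "C \<subseteq> X" "card C = k" "\<And>x. x \<in> C \<Longrightarrow> N x \<noteq> {}"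
    "\<And>y x. (\<And>w. w \<in> X - C \<Longrightarrow> y \<in> N w) \<Longrightarrow> x \<in> X - C \<Longrightarrow> 2 \<le> card (N x)"
proof (cases "\<exists>w\<in>X. N w = {}")
  case True
  then obtain w where w: "w \<in> X" "N w = {}" by blast
  obtain C where C: "C \<subseteq> {x \<in> X. N x \<noteq> {}}" "card C = k"
    using obtain_subset_with_card_n[OF k(1)] by blast
  have "w \<in> X - C" using w C by blast
  then show thesis using that[of C] C w by blast
next
  case nonempty: False
  show thesis
  proof (cases "\<exists>z\<in>X. card (N z) = 1")
    case True
    then obtain z y0 where z: "z \<in> X" "N z = {y0}" by (auto simp: card_1_singleton_iff)
    obtain w where w: "w \<in> X" "y0 \<notin> N w" using not_all by blast
    have "card (X - {z, w}) = card X - card {z, w}"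
      using X z w by (intro card_Diff_subset) auto
    moreover have "card {z, w} \<le> 2" by (simp add: card_insert_if)
    ultimately have k': "k \<le> card (X - {z, w})" using k(2) by linarith
    obtain C where C: "C \<subseteq> X - {z, w}" "card C = k"
      using obtain_subset_with_card_n[OF k'] by blast
    show thesis
    proof (rule that[of C])
      fix y x assume "\<And>w. w \<in> X - C \<Longrightarrow> y \<in> N w"
      then have "y \<in> N z" "y \<in> N w" using C z w by auto
      then show "2 \<le> card (N x)" using z w by simp
    qed (use C nonempty in auto)
  next
    case False
    obtain C where C: "C \<subseteq> X" "card C = k"
      using obtain_subset_with_card_n[of k X] k(2) by auto
    have "2 \<le> card (N x)" if "x \<in> X" for x
    proof -
      have "card (N x) \<noteq> 0" using nonempty fin that by simp
      moreover have "card (N x) \<noteq> 1" using False that by blast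
      ultimately show ?thesis by linarith
    qed
    then show thesis using that[of C] C nonempty by blast
  qed
qed

section \<open>Cliques with two vertices: double stars\<close>

text \<open>One colour suffices. Doubling an edge from \<open>x0\<close> to a leaf \<open>y0\<close>
  gives \<open>x0\<close> degree \<open>card N0 + 2\<close>, more than \<open>card N1 + 1\<close> at
  \<open>x1\<close> and more than 2 at \<open>y0\<close>; all other leaves have degree 1.\<close>

lemma D_lir_le_1_double_star:
  assumes E: "E = insert {x0, x1} ((\<lambda>y. {x0, y}) ` N0 \<union> (\<lambda>y. {x1, y}) ` N1)"
    and fin: "finite N0" "finite N1"
    and disj: "x0 \<noteq> x1" "N0 \<inter> N1 = {}" "x0 \<notin> N0 \<union> N1" "x1 \<notin> N0 \<union> N1"
    and ne: "N0 \<noteq> {}" and le: "card N1 \<le> card N0"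
  shows "D_lir E \<le> 1"
proof -
  obtain y0 where y0: "y0 \<in> N0" using ne by blast
  have inj: "inj_on (\<lambda>y. {x, y}) N" for x and N :: "'a set"
    by (auto simp: inj_on_def doubleton_eq_iff)
  have "{e \<in> E. x0 \<in> e} = insert {x0, x1} ((\<lambda>y. {x0, y}) ` N0)"
    using disj unfolding E by auto
  moreover have "{x0, x1} \<notin> (\<lambda>y. {x0, y}) ` N0" using disj by (auto simp: doubleton_eq_iff)
  ultimately have d0: "card {e \<in> E. x0 \<in> e} = card N0 + 1"
    using fin inj by (simp add: card_image)
  have "{e \<in> E. x1 \<in> e} = insert {x0, x1} ((\<lambda>y. {x1, y}) ` N1)"
    using disj unfolding E by auto
  moreover have "{x0, x1} \<notin> (\<lambda>y. {x1, y}) ` N1" using disj by (auto simp: doubleton_eq_iff)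
  ultimately have d1: "card {e \<in> E. x1 \<in> e} = card N1 + 1"
    using fin inj by (simp add: card_image)
  have "{e \<in> E. y \<in> e} = {{x0, y}}" if "y \<in> N0" for y using that disj unfolding E by auto
  then have dy0: "card {e \<in> E. y \<in> e} = 1" if "y \<in> N0" for y using that by simp
  have "{e \<in> E. y \<in> e} = {{x1, y}}" if "y \<in> N1" for y using that disj unfolding E by auto
  then have dy1: "card {e \<in> E. y \<in> e} = 1" if "y \<in> N1" for y using that by simp
  have dbl: "card {e \<in> {{x0, y0}}. v \<in> e} = (if v = x0 \<or> v = y0 then 1 else 0)" for v
  proof -
    have "{e \<in> {{x0, y0}}. v \<in> e} = (if v = x0 \<or> v = y0 then {{x0, y0}} else {})" by auto
    then show ?thesis by simp
  qed
  have pos: "0 < card N0" using ne fin by (simp add: card_gt_0_iff)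
  define t where "t v = card {e \<in> E. v \<in> e} + (if v = x0 \<or> v = y0 then 1 else 0)" for v
  have t01: "t x0 \<noteq> t x1" using d0 d1 le disj y0 by (auto simp: t_def)
  have t0: "t x0 \<noteq> t y" if "y \<in> N0" for y using d0 dy0[OF that] pos by (simp add: t_def)
  have t1: "t x1 \<noteq> t y" if "y \<in> N1" for y
  proof -
    have "0 < card N1" using that fin by (auto simp: card_gt_0_iff)
    then show ?thesis using d1 dy1[OF that] y0 disj that by (auto simp: t_def)
  qed
  show ?thesis
  proof (rule D_lir_le_1I[of E "{{x0, y0}}" "\<lambda>_. True"])
    show "finite E" unfolding E using fin by simp
    show "{{x0, y0}} \<subseteq> E" unfolding E using y0 by simp
    fix u v assume "{u, v} \<in> E"
    then consider "{u, v} = {x0, x1}" | y where "y \<in> N0" "{u, v} = {x0, y}" | y where "y \<in> N1" "{u, v} = {x1, y}"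
      unfolding E by blast
    then have "t u \<noteq> t v"
    proof cases
      case 1
      then show ?thesis using t01 by (fastforce simp: doubleton_eq_iff)
    next
      case 2
      then show ?thesis using t0[of y] by (fastforce simp: doubleton_eq_iff)
    next
      case 3
      then show ?thesis using t1[of y] by (fastforce simp: doubleton_eq_iff)
    qed
    moreover have "t w = card {e \<in> E. w \<in> e \<and> True = True} + card {e \<in> {{x0, y0}}. w \<in> e \<and> True = True}" for w
      unfolding t_def dbl[of w, symmetric] by simp
    ultimately show "card {e \<in> E. u \<in> e \<and> True = True} + card {e \<in> {{x0, y0}}. u \<in> e \<and> True = True} \<noteq>
        card {e \<in> E. v \<in> e \<and> True = True} + card {e \<in> {{x0, y0}}. v \<in> e \<and> True = True}"
      by metis
  qed simp
qed

section \<open>Numberings that suit the colourings\<close>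

lemma D_lir_le_1_indexed_many:
  fixes X Y :: "'a set"
  defines "N \<equiv> \<lambda>E x. {y \<in> Y. {x, y} \<in> E}"
  assumes ix: "\<And>g. bij_betw g {..<card X} X \<Longrightarrow> split_indexing X Y E g (card X)"
    and X: "finite X" "3 \<le> card X" and Y: "finite Y"
    and not_all: "\<And>y. \<exists>x\<in>X. y \<notin> N E x"
    and many: "card X div 2 \<le> card {x \<in> X. N E x \<noteq> {}}"
  shows "D_lir E \<le> 1"
proof -
  define n where "n = card X"
  have "n div 2 + 2 \<le> n" using X by (simp add: n_def)
  then obtain C where C: "C \<subseteq> X" "card C = n div 2" "\<And>x. x \<in> C \<Longrightarrow> N E x \<noteq> {}"
    and full: "\<And>y x. (\<And>w. w \<in> X - C \<Longrightarrow> y \<in> N E w) \<Longrightarrow> x \<in> X - C \<Longrightarrow> 2 \<le> card (N E x)"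
    using obtain_attached_set[of X "n div 2" "N E"] X(1) many not_all Y unfolding n_def N_def by auto
  \<comment> \<open>\<open>A\<close> receives the lower numbers. The twin that needs a neighbour is
    \<open>n div 2\<close> for even \<open>n\<close> and \<open>n div 2 - 1\<close> for odd
    \<open>n\<close>, so \<open>C\<close> has to be the upper half in the first case and the lower
    half in the second.\<close>
  define A where "A = (if even n then X - C else C)"
  have A: "A \<subseteq> X" using C by (auto simp: A_def)
  have "card (X - C) = n - n div 2"
    using C(2) card_Diff_subset[OF finite_subset[OF C(1) X(1)] C(1)] by (simp add: n_def)
  then have card_A: "card A = n div 2" using C(2) by (auto simp: A_def elim!: evenE)
  obtain g where g: "bij_betw g {..<n} X" and mem: "\<And>i. i < n \<Longrightarrow> g i \<in> A \<longleftrightarrow> i < n div 2"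
    and dec: "\<And>i j. i \<le> j \<Longrightarrow> j < n div 2 \<Longrightarrow> card (N E (g j)) \<le> card (N E (g i))"
    and inc: "\<And>i j. n div 2 \<le> i \<Longrightarrow> i \<le> j \<Longrightarrow> j < n \<Longrightarrow> card (N E (g i)) \<le> card (N E (g j))"
    using sorted_enumeration[OF X(1) A, of "\<lambda>x. card (N E x)"] unfolding card_A n_def[symmetric] by blast
  have gX: "g i \<in> X" if "i < n" for i using g that by (auto simp: bij_betw_def)
  have g_ex: "\<exists>i<n. x = g i" if "x \<in> X" for x using g that by (auto simp: bij_betw_def)
  interpret split_indexing X Y E g n using ix g by (simp add: n_def)
  have attached: "attached i = N E (g i)" for i by (simp add: attached_def N_def)
  have fin: "finite (N E x)" for x using Y by (simp add: N_def)
  have n3: "3 \<le> n" using X by (simp add: n_def)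
  show ?thesis
  proof (rule D_lir_le_1_many)
    show "2 \<le> n" using n3 by simp
    show "0 < card (attached (n div 2))" if "even n"
    proof -
      have "g (n div 2) \<in> C"
        using mem[of "n div 2"] gX[of "n div 2"] that n3 by (auto simp: A_def)
      then show ?thesis using C(3) fin by (simp add: attached card_gt_0_iff)
    qed
    show "0 < card (attached (n div 2 - 1))" if "odd n"
    proof -
      have "g (n div 2 - 1) \<in> C"
        using mem[of "n div 2 - 1"] that n3 by (auto simp: A_def)
      then show ?thesis using C(3) fin by (simp add: attached card_gt_0_iff)
    qed
    show "2 \<le> card (attached i)" if "even n" "\<forall>k<n div 2. y \<in> attached k" "i < n div 2" for y i
      unfolding attached
    proof (rule full)
      show "y \<in> N E w" if "w \<in> X - C" for w
        using g_ex[of w] mem that \<open>even n\<close> \<open>\<forall>k<n div 2. y \<in> attached k\<close> by (auto simp: A_def attached)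
      have "i < n" using that(3) by linarith
      then show "g i \<in> X - C" using mem[of i] that by (simp add: A_def)
    qed
    show "2 \<le> card (attached i)" if "odd n" "\<forall>k\<in>{n div 2..<n}. y \<in> attached k" "i \<in> {n div 2..<n}" for y i
      unfolding attached
    proof (rule full)
      show "y \<in> N E w" if w: "w \<in> X - C" for w
      proof -
        obtain k where k: "k < n" "w = g k" using g_ex w by blast
        then have "\<not> k < n div 2" using mem[of k] w \<open>odd n\<close> by (auto simp: A_def)
        then show ?thesis using k \<open>\<forall>k\<in>{n div 2..<n}. y \<in> attached k\<close> by (simp add: attached)
      qed
      show "g i \<in> X - C" using mem[of i] gX[of i] that by (simp add: A_def)
    qed
  qed (use dec inc attached in auto)
qed

text \<open>The lower half \<open>A\<close> is chosen to contain all clique vertices with neighbours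
  in \<open>Y\<close> except \<open>v\<close>. These are at most \<open>n div 2 - 2\<close> many and
  come first in the decreasing order. Outside \<open>A\<close> only \<open>v\<close> has neighbours,
  so the increasing order puts it last.\<close>

lemma D_lir_le_1_indexed_few:
  fixes X Y :: "'a set"
  defines "N \<equiv> \<lambda>E x. {y \<in> Y. {x, y} \<in> E}"
  assumes ix: "\<And>g. bij_betw g {..<card X} X \<Longrightarrow> split_indexing X Y E g (card X)"
    and X: "finite X" and Y: "finite Y"
    and v: "v \<in> X" "N E v \<noteq> {}"
    and few: "card {x \<in> X. N E x \<noteq> {}} < card X div 2"
  shows "D_lir E \<le> 1"
proof -
  define n where "n = card X"
  define P where "P = {x \<in> X. N E x \<noteq> {}}"
  have P: "P \<subseteq> X" "finite P" "v \<in> P" using v X by (auto simp: P_def)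
  have card_P: "0 < card P" "card P < n div 2"
    using P(2,3) few by (auto simp: card_gt_0_iff) (simp add: P_def n_def)
  have c: "card (P - {v}) = card P - 1" "card (X - {v}) = n - 1"
    using P v X by (simp_all add: n_def)
  have "card (P - {v}) \<le> n div 2" "n div 2 \<le> card (X - {v})" using c card_P by linarith+
  moreover have "P - {v} \<subseteq> X - {v}" "finite (X - {v})" using P X by auto
  ultimately obtain A where A: "P - {v} \<subseteq> A" "A \<subseteq> X - {v}" "card A = n div 2"
    using exists_subset_between[of "P - {v}" "n div 2" "X - {v}"] by blast
  have AX: "A \<subseteq> X" using A by blast
  obtain g where g: "bij_betw g {..<n} X" and mem: "\<And>i. i < n \<Longrightarrow> g i \<in> A \<longleftrightarrow> i < n div 2"
    and dec: "\<And>i j. i \<le> j \<Longrightarrow> j < n div 2 \<Longrightarrow> card (N E (g j)) \<le> card (N E (g i))"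
    and inc: "\<And>i j. n div 2 \<le> i \<Longrightarrow> i \<le> j \<Longrightarrow> j < n \<Longrightarrow> card (N E (g i)) \<le> card (N E (g j))"
    using sorted_enumeration[OF X AX, of "\<lambda>x. card (N E x)"] unfolding A(3) n_def[symmetric] by blast
  have gX: "g i \<in> X" if "i < n" for i using g that by (auto simp: bij_betw_def)
  have g_inj: "i = j" if "g i = g j" "i < n" "j < n" for i j
    using g that by (auto simp: bij_betw_def inj_on_def)
  have fin: "finite (N E x)" for x using Y by (simp add: N_def)
  have in_P: "0 < card (N E (g i)) \<longleftrightarrow> g i \<in> P" if "i < n" for i
    using gX[OF that] fin by (auto simp: P_def card_gt_0_iff)
  have n4: "4 \<le> n" using card_P by linarith
  obtain j where j: "j < n" "g j = v" using g v by (auto simp: bij_betw_def)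
  have jge: "n div 2 \<le> j" using mem[OF j(1)] j(2) A(2) by force
  have "0 < card (N E (g j))" using in_P[OF j(1)] j(2) P by simp
  moreover have "card (N E (g j)) \<le> card (N E (g (n - 1)))" using jge j(1) by (intro inc) linarith+
  ultimately have last: "0 < card (N E (g (n - 1)))" by linarith
  have v_last: "g (n - 1) = v"
    using in_P[of "n - 1"] last mem[of "n - 1"] n4 A(1) by auto
  interpret split_indexing X Y E g n using ix g by (simp add: n_def)
  have attached: "attached i = N E (g i)" for i by (simp add: attached_def N_def)
  have pos: "attached (n - 1) \<noteq> {}" using last by (auto simp: attached)
  have zero: "attached i = {}" if i: "n div 2 - 2 \<le> i" "i < n - 1" for i
  proof (rule ccontr)
    assume "attached i \<noteq> {}"
    then have pos_i: "0 < card (N E (g i))" using fin by (simp add: attached card_gt_0_iff)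
    have ne_v: "g k \<noteq> v" if "k \<le> i" for k using g_inj[of k "n - 1"] v_last that i by auto
    show False
    proof (cases "i < n div 2")
      case True
      \<comment> \<open>Vertices up to \<open>i\<close> have at least as many neighbours as
        \<open>i\<close>, so \<open>i + 1\<close> of them would lie in \<open>P - {v}\<close>, which
        has at most \<open>n div 2 - 2\<close> elements.\<close>
      have "g ` {..i} \<subseteq> P - {v}"
      proof
        fix x assume "x \<in> g ` {..i}"
        then obtain k where k: "k \<le> i" "x = g k" by auto
        then have "0 < card (N E (g k))" using dec[OF k(1) True] pos_i by simp
        then show "x \<in> P - {v}" using in_P[of k] k ne_v i by simp
      qed
      then have "card (g ` {..i}) \<le> card P - 1" using c(1) P(2) card_mono[of "P - {v}"] by force
      moreover have "inj_on g {..i}" using g_inj i by (auto simp: inj_on_def)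
      ultimately have "i + 1 \<le> card P - 1" by (simp add: card_image)
      then show False using i card_P by linarith
    next
      case False
      then have "g i \<notin> A" using mem[of i] i by simp
      moreover have "i < n" using i by linarith
      ultimately show False using A(1) in_P[of i] pos_i ne_v[of i] by auto
    qed
  qed
  show ?thesis
  proof (cases "n \<le> 6")
    case True
    then show ?thesis using D_lir_le_1_few_small[OF n4] zero pos by blast
  next
    case False
    then have "7 \<le> n" by simp
    then show ?thesis using D_lir_le_1_few_large dec zero pos unfolding attached by blast
  qed
qed

section \<open>Normalising the partition and splitting into cases\<close>

theorem mainTheorem9:
  fixes V :: "'a set" and E :: "'a set set"
  assumes "simple_graph V E"
    and "connected_graph V E"
    and "split_graph V E"
    and "\<not> complete_graph V E"
    and "\<not> graph_isomorphic V E (K_verts 2) (K_edges 2)"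
    and "\<not> graph_isomorphic V E (K_verts 3) (K_edges 3)"
  shows "D_lir E \<le> 1"
proof -
  obtain X Y where XY: "X \<union> Y = V" "X \<inter> Y = {}" "clique E X" "independent_set E Y"
    and no_all: "\<And>y. y \<in> Y \<Longrightarrow> \<exists>x\<in>X. {x, y} \<notin> E"
  proof -
    obtain X Y where XY: "X \<union> Y = V" "X \<inter> Y = {}" "clique E X" "independent_set E Y"
      using assms(3) unfolding split_graph_def by blast
    show thesis
    proof (cases "\<exists>y\<in>Y. \<forall>x\<in>X. {x, y} \<in> E")
      case True
      \<comment> \<open>A vertex \<open>y\<close> adjacent to all of \<open>X\<close> can be moved
        into the clique. No remaining vertex of \<open>Y\<close> is adjacent to \<open>y\<close>, so
        none sees the whole enlarged clique.\<close>
      then obtain y where y: "y \<in> Y" "\<And>x. x \<in> X \<Longrightarrow> {x, y} \<in> E" by blast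
      show thesis
      proof (rule that[of "insert y X" "Y - {y}"])
        show "clique E (insert y X)"
          using XY(3) y(2) unfolding clique_def by (metis insert_iff insert_commute)
        show "\<exists>x\<in>insert y X. {x, y'} \<notin> E" if "y' \<in> Y - {y}" for y'
          using XY(4) y(1) that unfolding independent_set_def by blast
        show "insert y X \<union> (Y - {y}) = V" "insert y X \<inter> (Y - {y}) = {}" using XY(1,2) y(1) by blast+
        show "independent_set E (Y - {y})" using XY(4) by (simp add: independent_set_def)
      qed
    next
      case False
      show thesis
      proof (rule that[OF XY])
        show "\<exists>x\<in>X. {x, y} \<notin> E" if "y \<in> Y" for y using False that by blast
      qed
    qed
  qed
  have finV: "finite V" and E2: "\<And>e. e \<in> E \<Longrightarrow> e \<subseteq> V \<and> card e = 2"
    using assms(1) by (auto simp: simple_graph_def)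
  then have fin: "finite X" "finite Y" using XY by auto
  define N where "N x = {y \<in> Y. {x, y} \<in> E}" for x
  have edge_cases: "(\<exists>x\<in>X. \<exists>x'\<in>X. x \<noteq> x' \<and> e = {x, x'}) \<or> (\<exists>x\<in>X. \<exists>y\<in>Y. e = {x, y})"
    if e: "e \<in> E" for e
  proof -
    obtain u w where uw: "e = {u, w}" "u \<noteq> w" using E2[OF e] by (auto simp: card_2_iff)
    then have "u \<in> X \<union> Y" "w \<in> X \<union> Y" using E2[OF e] XY(1) by auto
    moreover have "\<not> (u \<in> Y \<and> w \<in> Y)" using XY(4) e uw by (auto simp: independent_set_def)
    ultimately show ?thesis using uw by (auto simp: insert_commute)
  qed
  have ix: "split_indexing X Y E g (card X)" if "bij_betw g {..<card X} X" for g
    by unfold_locales (use fin XY edge_cases that in auto)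
  \<comment> \<open>As the graph is not complete, \<open>Y\<close> has a vertex \<open>y0\<close>.
    It misses some \<open>x1\<close> by the choice of the partition and has a neighbour
    \<open>x0\<close> by connectedness, so the clique has at least two vertices.\<close>
  have "Y \<noteq> {}" using assms(4) XY by (auto simp: complete_graph_def)
  then obtain y0 where y0: "y0 \<in> Y" by blast
  then obtain x1 where x1: "x1 \<in> X" "{x1, y0} \<notin> E" using no_all by blast
  obtain x0 where x0: "x0 \<in> X" "{x0, y0} \<in> E"
  proof -
    have "(y0, x1) \<in> (adjacency E)\<^sup>*"
      using assms(2) y0 x1 XY(1) by (auto simp: connected_graph_def)
    moreover have "y0 \<noteq> x1" using y0 x1 XY(2) by blast
    ultimately obtain w where w: "{y0, w} \<in> E"
      by (auto elim: converse_rtranclE simp: adjacency_def)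
    then have "w \<in> X" using edge_cases[OF w] y0 XY(2) by (auto simp: doubleton_eq_iff)
    then show thesis using that w by (metis insert_commute)
  qed
  have x01: "x0 \<noteq> x1" using x0 x1 by blast
  have N0: "N x0 \<noteq> {}" using x0 y0 by (auto simp: N_def)
  have not_all: "\<exists>x\<in>X. y \<notin> N x" for y
    using no_all[of y] x0(1) by (cases "y \<in> Y") (auto simp: N_def)
  have "card {x0, x1} \<le> card X" using x0 x1 fin by (intro card_mono) auto
  then consider "card X = 2" | "3 \<le> card X" using x01 by fastforce
  then show ?thesis
  proof cases
    case 1
    then have X: "X = {x0, x1}" using card_subset_eq[OF fin(1), of "{x0, x1}"] x0 x1 x01 by auto
    have E: "E = insert {x0, x1} ((\<lambda>y. {x0, y}) ` N x0 \<union> (\<lambda>y. {x1, y}) ` N x1)"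
    proof (intro equalityI subsetI)
      fix e assume "e \<in> E"
      then show "e \<in> insert {x0, x1} ((\<lambda>y. {x0, y}) ` N x0 \<union> (\<lambda>y. {x1, y}) ` N x1)"
        using edge_cases[of e] unfolding X N_def by auto
    next
      fix e assume "e \<in> insert {x0, x1} ((\<lambda>y. {x0, y}) ` N x0 \<union> (\<lambda>y. {x1, y}) ` N x1)"
      then show "e \<in> E" using XY(3) x01 by (auto simp: X N_def clique_def)
    qed
    have finN: "finite (N x)" for x using fin by (simp add: N_def)
    \<comment> \<open>No vertex of \<open>Y\<close> sees both vertices of \<open>X\<close>, so the
      graph is a double star.\<close>
    have disj: "N x0 \<inter> N x1 = {}" using not_all unfolding X by auto
    have not_N: "x0 \<notin> N x0 \<union> N x1" "x1 \<notin> N x0 \<union> N x1"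
      using XY(2) x0 x1 by (auto simp: N_def)
    show ?thesis
    proof (cases "card (N x1) \<le> card (N x0)")
      case True
      then show ?thesis using D_lir_le_1_double_star[OF E] finN x01 disj not_N N0 by blast
    next
      case False
      have "E = insert {x1, x0} ((\<lambda>y. {x1, y}) ` N x1 \<union> (\<lambda>y. {x0, y}) ` N x0)"
        by (subst E) (simp add: insert_commute Un_commute)
      moreover have "N x1 \<noteq> {}" using False by auto
      ultimately show ?thesis
        using D_lir_le_1_double_star[of E x1 x0 "N x1" "N x0"] finN x01 disj not_N False by auto
    qed
  next
    case 2
    show ?thesis
    proof (cases "card X div 2 \<le> card {x \<in> X. N x \<noteq> {}}")
      case True
      then show ?thesis
        using D_lir_le_1_indexed_many[OF ix fin(1) 2 fin(2)] not_all unfolding N_def by blast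
    next
      case False
      then show ?thesis
        using D_lir_le_1_indexed_few[OF ix fin x0(1)] N0 unfolding N_def by simp
    qed
  qed
qed

end
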